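(* Let $d\ge1$ and let $m>n\ge1$ be coprime integers. For every $\Delta\cong(c_{i,j})\in\mathcal{A}dm(dn,dm)$: (a) The move indices $\tilde{\mathbf{p}}_u$ ($1\le u\le d-1$) are well-defined and satisfy $$0<\tilde{\mathbf{p}}_1<\tilde{\mathbf{p}}_2<\cdots<\tilde{\mathbf{p}}_{d-1}\le(d-1)n.$$ (b) The map $$\Phi_d:\mathcal{A}dm(dn,dm)\longrightarrow\mathcal{Y}(dn,dm),\qquad(c_{i,j})\mapsto(c^{[d-1]}_{i,j}),$$ is well-defined.
   Context: Notation: $\mathbb{N}=\{0,1,\dots\}$. Indices run over $0\le i\le d-1$, $0\le j\le n-1$; a family indexed by $(i,j)$ is also indexed by $x=in+j$. $\Gamma\subset\mathbb{N}$ is the semigroup (with $0$) generated by $dn,dm,dmn+1$; $\hat a_{i,j}=jdm+(dmn+1)i$; $a_{i,j}=a_{in+j}=mi+\lfloor jm/n\rfloor$. $\mathcal{A}dm(dn,dm)$ is the set of $\Delta\subset\mathbb{N}$ with $\min\Delta=0$, $\Gamma+\Delta\subset\Delta$, such that for every $0\le i\le d-1$ there is $a\in A(\Delta)$ with $a\equiv i\pmod d$ and $a+dm+1\in\Delta$, where $\Delta=\bigsqcup_{a\in A(\Delta)}(a+dn\mathbb{N})$. One writes uniquely $A(\Delta)=\{\hat a_{i,j}-dn\,c_{i,j}\}$, $0\le c_{i,j}\le a_{i,j}$, and identifies $\Delta$ with $(c_{i,j})$. $\mathcal{Y}(dn,dm)$ is the set of integer families $(y_x)_{0\le x\le dn-1}$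 with $0\le y_x\le a_x$ and $y_x\le y_{x+1}$. Construction. Set $\mathrm{rk}^{[0]}_{\Delta,in+j}=\mathrm{rk}^{[0]}_{\Delta,i,j}=m(in+j)-nc_{i,j}$. For $u=1,\dots,d-1$, given $(\mathrm{rk}^{[u-1]}_{\Delta,i,j})$ (with the convention $\mathrm{rk}^{[u-1]}_{\Delta,u,n}:=\mathrm{rk}^{[u-1]}_{\Delta,u,0}$), define $$\tilde{\mathbf{p}}_u=\max\{in+j+1:\ 0\le i\le u-1,\ 0\le j\le n-1,\ \mathrm{rk}^{[u-1]}_{\Delta,u,j+1}\le\mathrm{rk}^{[u-1]}_{\Delta,i,j}+m\}$$ (well-defined means that this set is nonempty), and for $x=in+j$ set: $\mathrm{rk}^{[u]}_{\Delta,x}=\mathrm{rk}^{[u-1]}_{\Delta,x}$ if $0\le x<\tilde{\mathbf{p}}_u$ or $(u+1)n\le x<dn$; $\mathrm{rk}^{[u]}_{\Delta,x}=\mathrm{rk}^{[u-1]}_{\Delta,un+j}$ if $\tilde{\mathbf{p}}_u\le x<\tilde{\mathbf{p}}_u+n$; $\mathrm{rk}^{[u]}_{\Delta,x}=\mathrm{rk}^{[u-1]}_{\Delta,x-n}$ if $\tilde{\mathbf{p}}_u+n\le x<(u+1)n$. Put $\tilde{\mathbf{i}}_{j,u}=\min\{0\le i\le u:in+j\ge\tilde{\mathbf{p}}_u\}$, let $\tilde{\mathbf{s}}_{j,u}$ be the cycle $(\tilde{\mathbf{i}}_{j,u}\ \cdots\ u)$ on $\{0,\dots,d-1\}$ ($i\mapsto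 i+1$ for $\tilde{\mathbf{i}}_{j,u}\le i<u$, $u\mapsto\tilde{\mathbf{i}}_{j,u}$), and $\tilde{\mathbf{s}}_j=\tilde{\mathbf{s}}_{j,d-1}\circ\cdots\circ\tilde{\mathbf{s}}_{j,1}$. Finally $\Phi_d((c_{i,j}))=(c^{[d-1]}_{i,j})$ with $c^{[d-1]}_{i,j}=c_{\tilde{\mathbf{s}}_j^{-1}(i),j}-(\tilde{\mathbf{s}}_j^{-1}(i)-i)m$. *)

theory Defs
  imports Complex_Main "HOL-Library.FuncSet" "HOL-Library.Disjoint_Sets" "HOL-Number_Theory.Cong"
begin

text \<open>
  Every family indexed by pairs \<open>(i,j)\<close> with \<open>i < d\<close> and \<open>j < n\<close> is represented as a function of
  the single index \<open>x = i * n + j < d * n\<close>, so that \<open>i = x div n\<close> and \<open>j = x mod n\<close>.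
\<close>

definition Gam :: "nat \<Rightarrow> nat \<Rightarrow> nat \<Rightarrow> nat set" where
  "Gam d n m = {k1 * (d * n) + k2 * (d * m) + k3 * (d * m * n + 1) | k1 k2 k3. True}"

definition ahat :: "nat \<Rightarrow> nat \<Rightarrow> nat \<Rightarrow> nat \<Rightarrow> nat" where
  "ahat d n m x = (x mod n) * d * m + (d * m * n + 1) * (x div n)"

definition abound :: "nat \<Rightarrow> nat \<Rightarrow> nat \<Rightarrow> nat" where
  "abound n m x = m * (x div n) + ((x mod n) * m) div n"

definition progression :: "nat \<Rightarrow> nat \<Rightarrow> nat set" where
  "progression N a = {a + N * k | k. True}"

definition is_gens :: "nat \<Rightarrow> nat \<Rightarrow> nat set \<Rightarrow> nat set \<Rightarrow> bool" where
  "is_gens d n \<Delta> A \<longleftrightarrow>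
     disjoint_family_on (progression (d * n)) A \<and> \<Delta> = (\<Union>a\<in>A. progression (d * n) a)"

definition gens :: "nat \<Rightarrow> nat \<Rightarrow> nat set \<Rightarrow> nat set" where
  "gens d n \<Delta> = (THE A. is_gens d n \<Delta> A)"

definition Adm :: "nat \<Rightarrow> nat \<Rightarrow> nat \<Rightarrow> nat set set" where
  "Adm d n m = {\<Delta>. 0 \<in> \<Delta> \<and> (\<forall>g\<in>Gam d n m. \<forall>a\<in>\<Delta>. g + a \<in> \<Delta>) \<and>
     (\<forall>i<d. \<exists>a\<in>gens d n \<Delta>. a mod d = i mod d \<and> a + d * m + 1 \<in> \<Delta>)}"

definition is_coords :: "nat \<Rightarrow> nat \<Rightarrow> nat \<Rightarrow> nat set \<Rightarrow> (nat \<Rightarrow> int) \<Rightarrow> bool" where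
  "is_coords d n m \<Delta> c \<longleftrightarrow>
     c \<in> extensional {..<d * n} \<and> (\<forall>x<d * n. 0 \<le> c x \<and> c x \<le> int (abound n m x)) \<and>
     int ` gens d n \<Delta> = (\<lambda>x. int (ahat d n m x) - int (d * n) * c x) ` {..<d * n}"

definition coords :: "nat \<Rightarrow> nat \<Rightarrow> nat \<Rightarrow> nat set \<Rightarrow> nat \<Rightarrow> int" where
  "coords d n m \<Delta> = (THE c. is_coords d n m \<Delta> c)"

definition Yfam :: "nat \<Rightarrow> nat \<Rightarrow> nat \<Rightarrow> (nat \<Rightarrow> int) set" where
  "Yfam d n m = {y \<in> extensional {..<d * n}.
     (\<forall>x<d * n. 0 \<le> y x \<and> y x \<le> int (abound n m x)) \<and>
     (\<forall>x. x + 1 < d * n \<longrightarrow> y x \<le> y (x + 1))}"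

text \<open>
  The index \<open>u * n + Suc j mod n\<close> encodes the convention \<open>rk\<^bsub>u,n\<^esub> := rk\<^bsub>u,0\<^esub>\<close>; it is \<open>(u, j + 1)\<close> if
  \<open>j + 1 < n\<close>.
\<close>

definition move_cands :: "nat \<Rightarrow> nat \<Rightarrow> (nat \<Rightarrow> int) \<Rightarrow> nat \<Rightarrow> nat set" where
  "move_cands n m r u =
     {i * n + j + 1 | i j. i < u \<and> j < n \<and> r (u * n + Suc j mod n) \<le> r (i * n + j) + int m}"

definition move_index :: "nat \<Rightarrow> nat \<Rightarrow> (nat \<Rightarrow> int) \<Rightarrow> nat \<Rightarrow> nat" where
  "move_index n m r u = Max (move_cands n m r u)"

definition rk_step :: "nat \<Rightarrow> nat \<Rightarrow> nat \<Rightarrow> (nat \<Rightarrow> int) \<Rightarrow> nat \<Rightarrow> int" where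
  "rk_step n m u r x =
     (let p = move_index n m r u in
        if x < p \<or> (u + 1) * n \<le> x then r x
        else if x < p + n then r (u * n + x mod n)
        else r (x - n))"

text \<open>
  \<open>rk n m c u\<close> is the family \<open>rk\<^sup>[\<^sup>u\<^sup>]\<close> attached to \<open>c\<close>; only its values at \<open>x < d * n\<close> are meaningful,
  for \<open>u < d\<close>.
\<close>

primrec rk :: "nat \<Rightarrow> nat \<Rightarrow> (nat \<Rightarrow> int) \<Rightarrow> nat \<Rightarrow> nat \<Rightarrow> int" where
  "rk n m c 0 = (\<lambda>x. int m * int x - int n * c x)"
| "rk n m c (Suc u) = rk_step n m (Suc u) (rk n m c u)"

definition p_cands :: "nat \<Rightarrow> nat \<Rightarrow> (nat \<Rightarrow> int) \<Rightarrow> nat \<Rightarrow> nat set" where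
  "p_cands n m c u = move_cands n m (rk n m c (u - 1)) u"

definition ptilde :: "nat \<Rightarrow> nat \<Rightarrow> (nat \<Rightarrow> int) \<Rightarrow> nat \<Rightarrow> nat" where
  "ptilde n m c u = move_index n m (rk n m c (u - 1)) u"

definition itilde :: "nat \<Rightarrow> nat \<Rightarrow> (nat \<Rightarrow> int) \<Rightarrow> nat \<Rightarrow> nat \<Rightarrow> nat" where
  "itilde n m c j u = Min {i. i \<le> u \<and> ptilde n m c u \<le> i * n + j}"

text \<open>The cycles are extended by the identity from \<open>{0..d-1}\<close> to all naturals.\<close>

definition scyc :: "nat \<Rightarrow> nat \<Rightarrow> (nat \<Rightarrow> int) \<Rightarrow> nat \<Rightarrow> nat \<Rightarrow> nat \<Rightarrow> nat" where
  "scyc n m c j u i =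
     (let i0 = itilde n m c j u in
        if i0 \<le> i \<and> i < u then i + 1 else if i = u then i0 else i)"

primrec sprod :: "nat \<Rightarrow> nat \<Rightarrow> (nat \<Rightarrow> int) \<Rightarrow> nat \<Rightarrow> nat \<Rightarrow> nat \<Rightarrow> nat" where
  "sprod n m c j 0 = id"
| "sprod n m c j (Suc u) = scyc n m c j (Suc u) \<circ> sprod n m c j u"

definition stilde :: "nat \<Rightarrow> nat \<Rightarrow> nat \<Rightarrow> (nat \<Rightarrow> int) \<Rightarrow> nat \<Rightarrow> nat \<Rightarrow> nat" where
  "stilde d n m c j = sprod n m c j (d - 1)"

definition Phi :: "nat \<Rightarrow> nat \<Rightarrow> nat \<Rightarrow> (nat \<Rightarrow> int) \<Rightarrow> nat \<Rightarrow> int" where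
  "Phi d n m c = (\<lambda>x\<in>{..<d * n}.
     let i = x div n; j = x mod n; k = inv (stilde d n m c j) i
     in c (k * n + j) - (int k - int i) * int m)"

text \<open>The two \<open>THE\<close> descriptions above denote uniquely determined objects.\<close>

lemma is_gens_unique:
  assumes N: "0 < d * n" and A: "is_gens d n \<Delta> A"
  shows "A = {a \<in> \<Delta>. \<forall>b\<in>\<Delta>. b < a \<longrightarrow> b mod (d * n) \<noteq> a mod (d * n)}"
proof -
  define N where "N = d * n"
  have N0: "0 < N" using N by (simp add: N_def)
  have disj: "\<And>a b. a \<in> A \<Longrightarrow> b \<in> A \<Longrightarrow> a \<noteq> b \<Longrightarrow> progression N a \<inter> progression N b = {}"
    and D: "\<Delta> = (\<Union>a\<in>A. progression N a)"
    using A by (auto simp: is_gens_def disjoint_family_on_def N_def)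
  have same: "a = b" if ab: "a \<in> A" "b \<in> A" "a mod N = b mod N" "b \<le> a" for a b
  proof -
    obtain q where "a = b + N * q"
      using ab(3,4) by (metis mod_eq_nat2E)
    hence "a \<in> progression N a \<inter> progression N b"
      by (auto simp: progression_def intro: exI[of _ 0])
    thus ?thesis using disj[OF ab(1,2)] by blast
  qed
  show ?thesis unfolding N_def[symmetric]
  proof (intro equalityI subsetI CollectI conjI ballI impI)
    fix a assume a: "a \<in> A"
    show "a \<in> \<Delta>" using a by (auto simp: D progression_def intro!: bexI[of _ a] exI[of _ 0])
    fix b assume b: "b \<in> \<Delta>" "b < a"
    then obtain e k where e: "e \<in> A" "b = e + N * k" by (auto simp: D progression_def)
    show "b mod N \<noteq> a mod N"
    proof
      assume "b mod N = a mod N"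
      hence "a mod N = e mod N" using e by simp
      moreover have "e \<le> a" using e b by simp
      ultimately have "a = e" using same[OF a e(1)] by simp
      thus False using e b by simp
    qed
  next
    fix a assume a: "a \<in> {a \<in> \<Delta>. \<forall>b\<in>\<Delta>. b < a \<longrightarrow> b mod N \<noteq> a mod N}"
    then obtain e k where e: "e \<in> A" "a = e + N * k" by (auto simp: D progression_def)
    have "e \<in> \<Delta>" using e(1) by (auto simp: D progression_def intro!: bexI[of _ e] exI[of _ 0])
    moreover have "e mod N = a mod N" using e by simp
    ultimately have "\<not> e < a" using a by blast
    thus "a \<in> A" using e by (cases "N * k = 0") auto
  qed
qed

lemma is_gens_exists:
  assumes N: "0 < d * n" and cl: "\<And>a. a \<in> \<Delta> \<Longrightarrow> a + d * n \<in> \<Delta>"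
  shows "is_gens d n \<Delta> {a \<in> \<Delta>. \<forall>b\<in>\<Delta>. b < a \<longrightarrow> b mod (d * n) \<noteq> a mod (d * n)}"
proof -
  define N where "N = d * n"
  define A where "A = {a \<in> \<Delta>. \<forall>b\<in>\<Delta>. b < a \<longrightarrow> b mod N \<noteq> a mod N}"
  have cl': "a + N * k \<in> \<Delta>" if "a \<in> \<Delta>" for a k
  proof (induction k)
    case (Suc k)
    show ?case using cl[OF Suc] by (simp add: N_def algebra_simps)
  qed (use that in simp)
  have "disjoint_family_on (progression N) A"
    unfolding disjoint_family_on_def
  proof (intro ballI impI)
    fix a b assume ab: "a \<in> A" "b \<in> A" "a \<noteq> b"
    hence "a mod N \<noteq> b mod N" unfolding A_def by (metis (mono_tags, lifting) linorder_neqE_nat mem_Collect_eq)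
    thus "progression N a \<inter> progression N b = {}"
      unfolding progression_def by (auto, metis mod_mult_self2)
  qed
  moreover have "\<Delta> = (\<Union>a\<in>A. progression N a)"
  proof (intro equalityI subsetI)
    fix x assume x: "x \<in> \<Delta>"
    define e where "e = (LEAST e. e \<in> \<Delta> \<and> e mod N = x mod N)"
    have e: "e \<in> \<Delta> \<and> e mod N = x mod N"
      unfolding e_def by (rule LeastI[of _ x]) (use x in simp)
    have le: "e \<le> b" if "b \<in> \<Delta>" "b mod N = x mod N" for b
      unfolding e_def by (rule Least_le) (use that in simp)
    have "e \<in> A" using e le unfolding A_def by force
    moreover have "e \<le> x" using le x by simp
    then obtain q where "x = e + N * q" using e by (metis mod_eq_nat2E)
    ultimately show "x \<in> (\<Union>a\<in>A. progression N a)" by (auto simp: progression_def)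
  next
    fix x assume "x \<in> (\<Union>a\<in>A. progression N a)"
    thus "x \<in> \<Delta>" using cl' by (auto simp: progression_def A_def)
  qed
  ultimately show ?thesis unfolding is_gens_def N_def[symmetric] A_def[symmetric] by (rule conjI)
qed

lemma gens_eq:
  assumes "0 < d * n" "\<And>a. a \<in> \<Delta> \<Longrightarrow> a + d * n \<in> \<Delta>"
  shows "gens d n \<Delta> = {a \<in> \<Delta>. \<forall>b\<in>\<Delta>. b < a \<longrightarrow> b mod (d * n) \<noteq> a mod (d * n)}"
  unfolding gens_def
  using is_gens_exists[OF assms] is_gens_unique[OF assms(1)] by (rule the_equality)

lemma ahat_decomp:
  assumes "x < d * n"
  shows "ahat d n m x = (x div n + d * (((x mod n) * m) mod n)) + d * n * abound n m x"
proof -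
  have "(x mod n) * m = ((x mod n) * m) mod n + n * (((x mod n) * m) div n)" by simp
  hence "(x mod n) * d * m = d * (((x mod n) * m) mod n) + d * n * (((x mod n) * m) div n)"
    by (metis (no_types, lifting) add_mult_distrib2 mult.assoc mult.commute)
  thus ?thesis by (simp add: ahat_def abound_def algebra_simps)
qed

lemma ahat_residue_less:
  fixes x d n m :: nat
  assumes "x < d * n"
  shows "x div n + d * (((x mod n) * m) mod n) < d * n"
proof -
  have n: "0 < n" using assms by (cases n) auto
  have "x div n < d" using assms n by (simp add: less_mult_imp_div_less)
  moreover have "((x mod n) * m) mod n + 1 \<le> n" using n by (simp add: Suc_leI)
  hence "d * (((x mod n) * m) mod n + 1) \<le> d * n" by (rule mult_le_mono2)
  ultimately show ?thesis by simp
qed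

lemma ahat_mod_bij:
  assumes cop: "coprime m n"
  shows "bij_betw (\<lambda>x. ahat d n m x mod (d * n)) {..<d * n} {..<d * n}"
proof -
  have inj: "inj_on (\<lambda>x. ahat d n m x mod (d * n)) {..<d * n}"
  proof (rule inj_onI)
    fix x y assume "x \<in> {..<d * n}" "y \<in> {..<d * n}"
      and eq: "ahat d n m x mod (d * n) = ahat d n m y mod (d * n)"
    hence x: "x < d * n" and y: "y < d * n" by auto
    have n: "0 < n" using x by (cases n) auto
    have res: "ahat d n m z mod (d * n) = z div n + d * (((z mod n) * m) mod n)"
      if "z < d * n" for z
      using ahat_decomp[OF that, of m] ahat_residue_less[OF that, of m] by simp
    have dl: "x div n < d" "y div n < d" using x y by (simp_all add: less_mult_imp_div_less)
    from eq have e: "x div n + d * (((x mod n) * m) mod n) = y div n + d * (((y mod n) * m) mod n)"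
      using res[OF x] res[OF y] by simp
    from arg_cong[OF e, of "\<lambda>z. z mod d"] have i: "x div n = y div n" using dl by simp
    hence "((x mod n) * m) mod n = ((y mod n) * m) mod n" using e dl by simp
    hence "[(x mod n) * m = (y mod n) * m] (mod n)" by (simp add: cong_def)
    hence "x mod n = y mod n"
      using cop by (metis cong_mult_rcancel_nat cong_def mod_mod_trivial)
    thus "x = y" using i by (metis div_mult_mod_eq)
  qed
  have "(\<lambda>x. ahat d n m x mod (d * n)) ` {..<d * n} \<subseteq> {..<d * n}"
    by (force intro: mod_less_divisor dest: gr_implies_not0)
  hence "(\<lambda>x. ahat d n m x mod (d * n)) ` {..<d * n} = {..<d * n}"
    using inj by (simp add: endo_inj_surj)
  thus ?thesis using inj by (simp add: bij_betw_def)
qed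

lemma is_coords_ex1:
  assumes "1 \<le> d" "1 \<le> n" "coprime m n" and D: "\<Delta> \<in> Adm d n m"
  shows "\<exists>!c. is_coords d n m \<Delta> c"
proof -
  define N where "N = d * n"
  define A where "A = gens d n \<Delta>"
  have N: "0 < N" using assms by (simp add: N_def)
  have z: "0 \<in> \<Delta>" and G: "\<And>g a. g \<in> Gam d n m \<Longrightarrow> a \<in> \<Delta> \<Longrightarrow> g + a \<in> \<Delta>"
    using D by (auto simp: Adm_def)
  have "N \<in> Gam d n m"
    unfolding Gam_def N_def by (intro CollectI exI[of _ 1] exI[of _ 0] conjI) auto
  hence cl: "\<And>a. a \<in> \<Delta> \<Longrightarrow> a + d * n \<in> \<Delta>" using G by (metis N_def add.commute)
  have Aeq: "A = {a \<in> \<Delta>. \<forall>b\<in>\<Delta>. b < a \<longrightarrow> b mod N \<noteq> a mod N}"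
    using gens_eq[of d n \<Delta>] N cl by (simp add: A_def N_def)
  have Ainj: "a = b" if "a \<in> A" "b \<in> A" "a mod N = b mod N" for a b
    using that unfolding Aeq by (metis (mono_tags, lifting) linorder_neqE_nat mem_Collect_eq)
  have bij: "bij_betw (\<lambda>x. ahat d n m x mod N) {..<N} {..<N}"
    using ahat_mod_bij[OF assms(3)] by (simp add: N_def)
  have ahatD: "ahat d n m x \<in> \<Delta>" for x
  proof -
    have "ahat d n m x \<in> Gam d n m" unfolding Gam_def ahat_def
      by (intro CollectI exI[of _ 0] exI[of _ "x mod n"] exI[of _ "x div n"] conjI)
        (auto simp: algebra_simps)
    from G[OF this z] show ?thesis by simp
  qed
  have ex: "\<exists>k. k \<le> abound n m x \<and> ahat d n m x - N * k \<in> A \<and> N * k \<le> ahat d n m x"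
    if x: "x < N" for x
  proof -
    define e where "e = (LEAST e. e \<in> \<Delta> \<and> e mod N = ahat d n m x mod N)"
    have e: "e \<in> \<Delta> \<and> e mod N = ahat d n m x mod N"
      unfolding e_def by (rule LeastI[of _ "ahat d n m x"]) (use ahatD in simp)
    have le: "e \<le> b" if "b \<in> \<Delta>" "b mod N = ahat d n m x mod N" for b
      unfolding e_def by (rule Least_le) (use that in simp)
    have eA: "e \<in> A" using e le unfolding Aeq by force
    have "e \<le> ahat d n m x" using le ahatD by simp
    then obtain k where k: "ahat d n m x = e + N * k" using e by (metis mod_eq_nat2E)
    have "ahat d n m x div N = abound n m x"
      using ahat_decomp[of x d n m] ahat_residue_less[of x d n m] x N by (simp add: N_def)
    hence "k \<le> abound n m x"
      using k N by (metis div_le_mono div_mult_self1_is_m le_add2)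
    thus ?thesis using k eA by (intro exI[of _ k]) simp
  qed
  then obtain k where k: "\<And>x. x < N \<Longrightarrow> k x \<le> abound n m x"
    "\<And>x. x < N \<Longrightarrow> ahat d n m x - N * k x \<in> A" "\<And>x. x < N \<Longrightarrow> N * k x \<le> ahat d n m x"
    by metis
  show ?thesis
  proof (rule ex1I)
    let ?c = "\<lambda>x\<in>{..<N}. int (k x)"
    have eq: "int (ahat d n m x) - int N * ?c x = int (ahat d n m x - N * k x)" if "x < N" for x
      using k(3)[OF that] that by (simp add: of_nat_diff)
    have "int ` A = (\<lambda>x. int (ahat d n m x) - int N * ?c x) ` {..<N}"
    proof (intro equalityI subsetI)
      fix t assume "t \<in> int ` A"
      then obtain a where a: "a \<in> A" "t = int a" by auto
      have "a mod N \<in> {..<N}" using N by simp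
      hence "a mod N \<in> (\<lambda>x. ahat d n m x mod N) ` {..<N}"
        using bij by (simp add: bij_betw_def)
      then obtain x where x: "x < N" "ahat d n m x mod N = a mod N"
        by auto
      have "(ahat d n m x - N * k x) mod N = ahat d n m x mod N"
        using k(3)[OF x(1)] by (metis le_add_diff_inverse2 mod_mult_self2)
      hence "a = ahat d n m x - N * k x" 
        using Ainj[OF a(1) k(2)[OF x(1)]] x(2) by metis
      hence "t = int (ahat d n m x) - int N * ?c x" using a(2) eq[OF x(1)] by simp
      thus "t \<in> (\<lambda>x. int (ahat d n m x) - int N * ?c x) ` {..<N}"
        using x(1) by (intro image_eqI[of _ _ x]) auto
    next
      fix t assume "t \<in> (\<lambda>x. int (ahat d n m x) - int N * ?c x) ` {..<N}"
      then obtain x where x: "x < N" "t = int (ahat d n m x) - int N * ?c x" by auto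
      thus "t \<in> int ` A" using eq[OF x(1)] k(2)[OF x(1)] by (metis image_eqI)
    qed
    thus "is_coords d n m \<Delta> ?c"
      using k(1) by (auto simp: is_coords_def A_def[symmetric] N_def[symmetric])
  next
    fix c assume "is_coords d n m \<Delta> c"
    hence c: "c \<in> extensional {..<N}"
      and im: "int ` A = (\<lambda>x. int (ahat d n m x) - int N * c x) ` {..<N}"
      unfolding is_coords_def A_def N_def by blast+
    show "c = (\<lambda>x\<in>{..<N}. int (k x))"
    proof (rule extensionalityI[OF c restrict_extensional])
      fix x assume "x \<in> {..<N}"
      hence x: "x < N" by simp
      have "int (ahat d n m x) - int N * c x \<in> int ` A" using im x by blast
      then obtain a where a: "a \<in> A" "int (ahat d n m x) - int N * c x = int a" by auto
      have "int a mod int N = int (ahat d n m x) mod int N"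
        using a(2) by (metis mod_diff_left_eq mod_mult_self1_is_0 mod_diff_right_eq diff_zero)
      hence "a mod N = ahat d n m x mod N" by (metis nat_int_comparison(1) zmod_int)
      moreover have "(ahat d n m x - N * k x) mod N = ahat d n m x mod N"
        using k(3)[OF x] by (metis le_add_diff_inverse2 mod_mult_self2)
      ultimately have "a = ahat d n m x - N * k x" using Ainj[OF a(1) k(2)[OF x]] by metis
      hence "int a = int (ahat d n m x) - int N * int (k x)"
        using k(3)[OF x] by (simp add: of_nat_diff)
      hence "int N * c x = int N * int (k x)" using a(2) by simp
      thus "c x = (\<lambda>x\<in>{..<N}. int (k x)) x" using N x by simp
    qed
  qed
qed

end

theory Submission
  imports Defs
begin

text \<open>
  Write \<open>g\<^sub>x\<close> for the generator of \<open>\<Delta>\<close> with coordinate \<open>c\<^sub>x\<close>. Then \<open>g\<^sub>x = d * rk\<^sub>x + x div n\<close>, where \<open>rk\<close>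
  is the initial family: row \<open>i\<close> of \<open>rk\<close> lists the \<open>n\<close>-generators of
  \<open>\<Delta>\<^sub>i = {t. d * t + i \<in> \<Delta>}\<close>, the one in column \<open>j\<close> being congruent to \<open>m * j\<close> modulo \<open>n\<close>. As a
  generator is the least element of \<open>\<Delta>\<close> in its class modulo \<open>d * n\<close>, the hypotheses on \<open>\<Delta>\<close> turn into
  inequalities between ranks. Closure under adding \<open>d * m\<close> says that along each row, read
  cyclically, the rank grows by at most \<open>m\<close> from one entry to the next. Admissibility says that for
  each \<open>u\<close> some entry of row \<open>u + 1\<close> exceeds by at most \<open>m\<close> the entry of row \<open>u\<close> in the preceding
  column. Also \<open>rk\<^sub>0 = 0\<close> and all ranks are nonnegative.

  Stage \<open>u\<close> inserts row \<open>u\<close>, suitably rotated, as one block at position \<open>p\<^sub>u\<close> into the word formed by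
  the earlier rows. Admissibility at row \<open>u\<close> provides a candidate for \<open>p\<^bsub>u+1\<^esub>\<close> located in the block that
  stage \<open>u\<close> has just inserted, which gives existence and \<open>p\<^bsub>u+1\<^esub> > p\<^sub>u\<close>
  (\<open>ptilde_increasing\<close>); all candidates lie in the first \<open>u\<close> rows, which gives the upper bound.

  The word of the first \<open>u + 1\<close> rows grows by at most \<open>m\<close> at each step (\<open>slow_rk_step\<close>): at the left
  end of the block this is the candidate condition, and at the right end it follows from the
  maximality of \<open>p\<^sub>u\<close>. Finally, the permutations \<open>sprod\<close> record how the stages move entries within a
  column, whence \<open>n * \<Phi>(c)\<^sub>x = m * x - rk\<^sup>[\<^sup>d\<^sup>-\<^sup>1\<^sup>]\<^sub>x\<close> (\<open>Phi_rk\<close>). Slow growth thus means that \<open>\<Phi>(c)\<close> is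
  nondecreasing; it starts at \<open>0\<close>, as position \<open>0\<close> never moves, and nonnegativity of ranks gives the
  upper bound \<open>a\<^sub>x\<close>.
\<close>

section \<open>Inserting one row\<close>

definition slow :: "nat \<Rightarrow> nat \<Rightarrow> (nat \<Rightarrow> int) \<Rightarrow> bool" where
  "slow m k r \<longleftrightarrow> (\<forall>x. Suc x < k \<longrightarrow> r (Suc x) \<le> r x + int m)"

definition cyclically_slow_row :: "nat \<Rightarrow> nat \<Rightarrow> (nat \<Rightarrow> int) \<Rightarrow> nat \<Rightarrow> bool" where
  "cyclically_slow_row n m r u \<longleftrightarrow>
     (\<forall>x. r (u * n + Suc x mod n) \<le> r (u * n + x mod n) + int m)"

lemma move_cands_iff:
  assumes "0 < n"
  shows "p \<in> move_cands n m r u \<longleftrightarrow>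
    (\<exists>x. p = Suc x \<and> x < u * n \<and> r (u * n + Suc x mod n) \<le> r x + int m)"
proof
  assume "p \<in> move_cands n m r u"
  then obtain i j where ij: "p = i * n + j + 1" "i < u" "j < n"
    "r (u * n + Suc j mod n) \<le> r (i * n + j) + int m"
    by (auto simp: move_cands_def)
  have "Suc (i * n + j) mod n = Suc j mod n"
    by (metis add_Suc_right mod_mult_self3)
  moreover have "i * n + j < u * n"
  proof -
    have "i * n + j < Suc i * n" using ij(3) by simp
    also have "\<dots> \<le> u * n" using ij(2) by (intro mult_le_mono1) simp
    finally show ?thesis .
  qed
  ultimately show "\<exists>x. p = Suc x \<and> x < u * n \<and> r (u * n + Suc x mod n) \<le> r x + int m"
    using ij by (intro exI[of _ "i * n + j"]) simp
next
  assume "\<exists>x. p = Suc x \<and> x < u * n \<and> r (u * n + Suc x mod n) \<le> r x + int m"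
  then obtain x where x: "p = Suc x" "x < u * n" "r (u * n + Suc x mod n) \<le> r x + int m"
    by blast
  have "Suc (x mod n) mod n = Suc x mod n" by (rule mod_Suc_eq)
  then show "p \<in> move_cands n m r u"
    unfolding move_cands_def using x assms
    by (intro CollectI exI[of _ "x div n"] exI[of _ "x mod n"])
      (simp add: less_mult_imp_div_less)
qed

lemma finite_move_cands:
  assumes "0 < n"
  shows "finite (move_cands n m r u)"
  by (rule finite_subset[of _ "{..u * n}"]) (auto simp: move_cands_iff[OF assms])

lemma move_index_ge:
  assumes "0 < n" "p \<in> move_cands n m r u"
  shows "p \<le> move_index n m r u"
  unfolding move_index_def using finite_move_cands[OF assms(1)] assms(2) by (rule Max_ge)

lemma move_index_cand:
  assumes "0 < n" "move_cands n m r u \<noteq> {}"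
  shows "move_index n m r u \<in> move_cands n m r u"
  unfolding move_index_def using finite_move_cands[OF assms(1)] assms(2) by (rule Max_in)

lemma move_index_bounds:
  assumes "0 < n" "move_cands n m r u \<noteq> {}"
  shows "0 < move_index n m r u" "move_index n m r u \<le> u * n"
  using move_index_cand[OF assms] by (auto simp: move_cands_iff[OF assms(1)])

text \<open>
  The only delicate place is the right end of the inserted block, where the entry \<open>r p\<close> displaced
  by the block follows the entry of row \<open>u\<close> in column \<open>p - 1\<close>. By maximality, \<open>p + 1\<close> is not a
  candidate, so \<open>r p + m\<close> lies below the entry of row \<open>u\<close> in column \<open>p + 1\<close>, and cyclic slow growth
  of row \<open>u\<close> bounds that entry by \<open>2 * m\<close> plus the one in column \<open>p - 1\<close>.
\<close>

lemma slow_rk_step: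
  assumes n: "0 < n" and sl: "slow m (u * n) r" and row: "cyclically_slow_row n m r u"
    and ne: "move_cands n m r u \<noteq> {}"
  shows "slow m (Suc u * n) (rk_step n m u r)"
  unfolding slow_def
proof (intro allI impI)
  fix x assume x: "Suc x < Suc u * n"
  define p where "p = move_index n m r u"
  have p: "0 < p" "p \<le> u * n" using move_index_bounds[OF n ne] by (simp_all add: p_def)
  have step: "rk_step n m u r z =
      (if z < p \<or> Suc u * n \<le> z then r z
       else if z < p + n then r (u * n + z mod n) else r (z - n))" for z
    by (simp add: rk_step_def p_def Let_def)
  have cyc: "r (u * n + Suc z mod n) \<le> r (u * n + z mod n) + int m" for z
    using row by (simp add: cyclically_slow_row_def)
  consider "Suc x < p" | "Suc x = p" | "p \<le> x" "Suc x < p + n" | "Suc x = p + n" | "p + n \<le> x"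
    by linarith
  then show "rk_step n m u r (Suc x) \<le> rk_step n m u r x + int m"
  proof cases
    case 1
    then show ?thesis using sl p by (simp add: step slow_def)
  next
    case 2
    have "p \<in> move_cands n m r u" using move_index_cand[OF n ne] by (simp add: p_def)
    then have "r (u * n + p mod n) \<le> r x + int m"
      using 2 by (auto simp: move_cands_iff[OF n])
    then show ?thesis using 2 x n by (simp add: step)
  next
    case 3
    then show ?thesis using x cyc[of x] by (simp add: step)
  next
    case 4
    have pu: "p < u * n" using 4 x by simp
    have "Suc p \<notin> move_cands n m r u"
      using move_index_ge[OF n, of "Suc p" m r u] by (auto simp: p_def)
    then have "r p + int m < r (u * n + Suc p mod n)"
      using pu by (auto simp: move_cands_iff[OF n])
    also have "\<dots> \<le> r (u * n + p mod n) + int m" by (rule cyc)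
    also have "p mod n = Suc x mod n" using 4 by simp
    also have "r (u * n + Suc x mod n) \<le> r (u * n + x mod n) + int m" by (rule cyc)
    finally have "r p \<le> r (u * n + x mod n) + int m" by simp
    then show ?thesis using 4 x n by (simp add: step)
  next
    case 5
    then have "Suc (x - n) < u * n" using x by simp
    then have "r (Suc (x - n)) \<le> r (x - n) + int m" using sl by (simp add: slow_def)
    moreover have "Suc x - n = Suc (x - n)" using 5 by simp
    ultimately show ?thesis using 5 x by (simp add: step)
  qed
qed

lemma rk_unchanged_above: "Suc u * n \<le> x \<Longrightarrow> rk n m c u x = rk n m c 0 x"
proof (induction u)
  case (Suc u)
  then have "Suc u * n \<le> x" by simp
  with Suc show ?case by (simp add: rk_step_def Let_def)
qed simp

lemma p_cands_Suc: "p_cands n m c (Suc u) = move_cands n m (rk n m c u) (Suc u)"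
  by (simp add: p_cands_def)

lemma ptilde_Suc: "ptilde n m c (Suc u) = move_index n m (rk n m c u) (Suc u)"
  by (simp add: ptilde_def)

section \<open>The column permutations\<close>

lemma itilde_props:
  assumes "ptilde n m c u \<le> u * n"
  shows "itilde n m c j u \<le> u"
    and "ptilde n m c u \<le> itilde n m c j u * n + j"
    and "i < itilde n m c j u \<Longrightarrow> i * n + j < ptilde n m c u"
proof -
  let ?S = "{i. i \<le> u \<and> ptilde n m c u \<le> i * n + j}"
  have fin: "finite ?S" by simp
  have "u \<in> ?S" using assms by simp
  then have "itilde n m c j u \<in> ?S"
    unfolding itilde_def using Min_in[OF fin] by blast
  then show le: "itilde n m c j u \<le> u" and "ptilde n m c u \<le> itilde n m c j u * n + j"
    by auto
  assume i: "i < itilde n m c j u"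
  then have "i \<notin> ?S" unfolding itilde_def using Min_le[OF fin, of i] by linarith
  then show "i * n + j < ptilde n m c u" using i le by simp
qed

lemma bij_scyc:
  assumes "itilde n m c j u \<le> u"
  shows "bij (scyc n m c j u)"
proof (rule o_bij)
  define a where "a = itilde n m c j u"
  define t where "t = (\<lambda>i. if a < i \<and> i \<le> u then i - 1 else if i = a then u else i)"
  have s: "scyc n m c j u i = (if a \<le> i \<and> i < u then i + 1 else if i = u then a else i)" for i
    by (simp add: scyc_def a_def Let_def)
  show "t \<circ> scyc n m c j u = id" "scyc n m c j u \<circ> t = id"
    using assms by (auto simp: fun_eq_iff s t_def a_def[symmetric])
qed

text \<open>
  The entry in row \<open>itilde\<close> is the first one of column \<open>j\<close> at or after the move index, so it is the
  one that lies in the inserted block; the entries of that column from there up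
  to row \<open>u\<close> move down by one row.
\<close>

lemma rk_step_scyc:
  assumes n: "0 < n" and j: "j < n" and p: "ptilde n m c (Suc u) \<le> Suc u * n"
  shows "rk n m c (Suc u) (scyc n m c j (Suc u) i * n + j) = rk n m c u (i * n + j)"
proof -
  define P where "P = ptilde n m c (Suc u)"
  define a where "a = itilde n m c j (Suc u)"
  define r where "r = rk n m c u"
  note a = itilde_props[OF p, where j = j, folded a_def P_def]
  have s: "scyc n m c j (Suc u) i =
      (if a \<le> i \<and> i < Suc u then i + 1 else if i = Suc u then a else i)"
    by (simp add: scyc_def a_def Let_def)
  have step: "rk n m c (Suc u) x =
      (if x < P \<or> Suc (Suc u) * n \<le> x then r x
       else if x < P + n then r (Suc u * n + x mod n) else r (x - n))" for x
    by (simp add: rk_step_def P_def ptilde_Suc Let_def r_def)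
  have row: "k * n + j < l * n" if "k < l" for k l
  proof -
    have "k * n + j < Suc k * n" using j by simp
    also have "\<dots> \<le> l * n" using that by (intro mult_le_mono1) simp
    finally show ?thesis .
  qed
  consider "i < a" | "a \<le> i" "i < Suc u" | "i = Suc u" | "Suc u < i" by linarith
  then show ?thesis
  proof cases
    case 1
    then show ?thesis using a(1) a(3)[OF 1] 1 by (simp add: s step r_def del: rk.simps)
  next
    case 2
    have "a * n \<le> i * n" using 2 by simp
    with a(2) have "P + n \<le> Suc i * n + j" unfolding mult_Suc by linarith
    moreover have "Suc i * n + j < Suc (Suc u) * n" using 2 by (intro row) simp
    moreover have "Suc i * n + j - n = i * n + j" by simp
    ultimately have "rk n m c (Suc u) (Suc i * n + j) = r (i * n + j)"
      unfolding step by simp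
    then show ?thesis using 2 by (simp add: s r_def)
  next
    case 3
    have P0: "a * n + j < P + n"
    proof (cases a)
      case 0
      then show ?thesis using j by simp
    next
      case (Suc b)
      then show ?thesis using a(3)[of b] by simp
    qed
    have up: "a * n + j < Suc (Suc u) * n" using a(1) by (intro row) simp
    have md: "(a * n + j) mod n = j" using j by simp
    have "rk n m c (Suc u) (a * n + j) = r (Suc u * n + j)"
      unfolding step md using a(2) P0 up by auto
    moreover have "scyc n m c j (Suc u) i = a" unfolding s using 3 by simp
    ultimately show ?thesis using 3 by (simp only: r_def)
  next
    case 4
    then have "Suc (Suc u) * n \<le> i * n" by (intro mult_le_mono1) simp
    then show ?thesis using 4 a(1) by (simp add: s step r_def del: rk.simps)
  qed
qed

lemma rk_sprod:
  assumes "0 < n" "j < n" "\<And>v. v < u \<Longrightarrow> ptilde n m c (Suc v) \<le> Suc v * n"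
  shows "rk n m c u (sprod n m c j u i * n + j) = rk n m c 0 (i * n + j)"
  using assms(3)
proof (induction u)
  case (Suc u)
  then show ?case
    using rk_step_scyc[OF assms(1,2), where u = u and i = "sprod n m c j u i"] by simp
qed simp

lemma bij_sprod:
  assumes "\<And>v. v < u \<Longrightarrow> ptilde n m c (Suc v) \<le> Suc v * n"
  shows "bij (sprod n m c j u)"
  using assms
proof (induction u)
  case (Suc u)
  then have "bij (scyc n m c j (Suc u))" by (intro bij_scyc itilde_props(1)) simp
  with Suc show ?case by (simp del: o_apply add: bij_comp)
qed simp

section \<open>Families of ranks satisfying the admissibility inequalities\<close>

text \<open>
  Since \<open>m * x\<close> is \<open>n * abound x\<close> plus the remainder \<open>(x mod n) * m mod n\<close>, a rank is nonnegative
  exactly when its coordinate respects the upper bound.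
\<close>

lemma le_abound:
  assumes n: "0 < n" and y: "0 \<le> int m * int x - int n * y"
  shows "y \<le> int (abound n m x)"
proof -
  have "m * x = m * (n * (x div n) + x mod n)" by simp
  also have "\<dots> = n * (m * (x div n)) + (x mod n) * m" by (simp only: algebra_simps)
  also have "\<dots> = n * (m * (x div n)) + (n * ((x mod n) * m div n) + (x mod n) * m mod n)"
    by simp
  also have "\<dots> = n * abound n m x + (x mod n) * m mod n"
    by (simp add: abound_def algebra_simps)
  also have "\<dots> < n * Suc (abound n m x)" using n by simp
  finally have "int (m * x) < int (n * Suc (abound n m x))" by (simp only: of_nat_less_iff)
  with y have "int n * y < int n * (int (abound n m x) + 1)" by (simp add: algebra_simps)
  then show ?thesis using n by simp
qed

locale admissible_ranks =
  fixes d n m :: nat and c :: "nat \<Rightarrow> int"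
  assumes d_pos: "0 < d" and n_pos: "0 < n"
    and slow_rows: "u < d \<Longrightarrow> cyclically_slow_row n m (rk n m c 0) u"
    and link: "Suc u < d \<Longrightarrow>
      \<exists>j<n. rk n m c 0 (Suc u * n + Suc j mod n) \<le> rk n m c 0 (u * n + j) + int m"
begin

lemma rk_row_unchanged: "rk n m c u (Suc u * n + k) = rk n m c 0 (Suc u * n + k)"
  by (rule rk_unchanged_above) simp

text \<open>
  The entry of row \<open>u\<close> supplied by \<open>link\<close> sits, after stage \<open>u\<close>, inside the block inserted at
  \<open>ptilde u\<close>; the position after it is a candidate at stage \<open>u + 1\<close>.
\<close>

lemma candidate_beyond:
  assumes "Suc u < d" and "0 < u \<Longrightarrow> p_cands n m c u \<noteq> {}"
  shows "\<exists>p\<in>p_cands n m c (Suc u). 0 < u \<longrightarrow> ptilde n m c u < p"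
proof -
  obtain j where j: "j < n"
    "rk n m c 0 (Suc u * n + Suc j mod n) \<le> rk n m c 0 (u * n + j) + int m"
    using link[OF assms(1)] by blast
  obtain x where x: "x < Suc u * n" "x mod n = j" "rk n m c u x = rk n m c 0 (u * n + j)"
    "0 < u \<longrightarrow> ptilde n m c u \<le> x"
  proof (cases u)
    case 0
    then show ?thesis using that[of j] j(1) by simp
  next
    case (Suc v)
    define a where "a = itilde n m c j u"
    have "ptilde n m c u \<le> u * n"
      unfolding Suc ptilde_Suc
      by (rule move_index_bounds(2)[OF n_pos]) (use assms(2) Suc in \<open>simp add: p_cands_Suc\<close>)
    note a = itilde_props[OF this, where j = j, folded a_def]
    have s: "scyc n m c j u u = a" by (simp add: scyc_def a_def Let_def)
    have "rk n m c u (a * n + j) = rk n m c v (u * n + j)"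
      using rk_step_scyc[OF n_pos j(1), of m c v u] \<open>ptilde n m c u \<le> u * n\<close> s Suc by simp
    also have "\<dots> = rk n m c 0 (u * n + j)" using rk_row_unchanged[of v j] Suc by simp
    finally have "rk n m c u (a * n + j) = rk n m c 0 (u * n + j)" .
    moreover have "a * n + j < Suc u * n"
    proof -
      have "a * n \<le> u * n" using a(1) by simp
      then show ?thesis using j(1) unfolding mult_Suc by linarith
    qed
    ultimately show ?thesis using that[of "a * n + j"] a(2) j(1) by simp
  qed
  have "Suc x mod n = Suc j mod n" using x(2) mod_Suc_eq[of x n] by simp
  then have "Suc x \<in> p_cands n m c (Suc u)"
    unfolding p_cands_Suc move_cands_iff[OF n_pos]
    using x j(2) rk_row_unchanged[of u "Suc j mod n"] by (intro exI[of _ x]) simp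
  then show ?thesis using x(4) by (intro bexI) auto
qed

lemma p_cands_nonempty: "Suc u < d \<Longrightarrow> p_cands n m c (Suc u) \<noteq> {}"
proof (induction u)
  case 0
  then show ?case using candidate_beyond[of 0] by auto
next
  case (Suc u)
  then show ?case using candidate_beyond[of "Suc u"] by auto
qed

lemma ptilde_bounds:
  assumes "Suc u < d"
  shows "0 < ptilde n m c (Suc u)" "ptilde n m c (Suc u) \<le> Suc u * n"
  using move_index_bounds[OF n_pos p_cands_nonempty[OF assms, unfolded p_cands_Suc]]
  by (simp_all add: ptilde_Suc)

lemma ptilde_increasing:
  assumes "Suc (Suc u) < d"
  shows "ptilde n m c (Suc u) < ptilde n m c (Suc (Suc u))"
proof -
  obtain p where p: "p \<in> p_cands n m c (Suc (Suc u))" "ptilde n m c (Suc u) < p"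
    using candidate_beyond[OF assms] p_cands_nonempty assms by auto
  then show ?thesis
    using move_index_ge[OF n_pos] unfolding p_cands_Suc ptilde_Suc
    by (meson order_less_le_trans)
qed

lemma strict_mono_ptilde: "strict_mono_on {1..d - 1} (ptilde n m c)"
proof (rule strict_mono_onI)
  fix u v assume uv: "u \<in> {1..d - 1}" "v \<in> {1..d - 1}" "u < v"
  have "Suc k \<le> l \<Longrightarrow> 0 < k \<Longrightarrow> l < d \<Longrightarrow> ptilde n m c k < ptilde n m c l" for k l
  proof (induction l rule: dec_induct)
    case base
    then show ?case using ptilde_increasing[of "k - 1"] by (cases k) simp_all
  next
    case (step l)
    then have "ptilde n m c l < ptilde n m c (Suc l)"
      using ptilde_increasing[of "l - 1"] by (cases l) simp_all
    with step show ?case by simp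
  qed
  with uv show "ptilde n m c u < ptilde n m c v" by auto
qed

lemma slow_rk: "u < d \<Longrightarrow> slow m (Suc u * n) (rk n m c u)"
proof (induction u)
  case 0
  have "rk n m c 0 (Suc x mod n) \<le> rk n m c 0 (x mod n) + int m" for x
    using slow_rows[OF 0] unfolding cyclically_slow_row_def by simp
  then have "rk n m c 0 (Suc x) \<le> rk n m c 0 x + int m" if "Suc x < n" for x
    by (metis Suc_lessD mod_less that)
  then show ?case by (simp add: slow_def del: rk.simps)
next
  case (Suc u)
  have "cyclically_slow_row n m (rk n m c u) (Suc u)"
    using slow_rows[OF Suc.prems] unfolding cyclically_slow_row_def rk_row_unchanged .
  moreover have "slow m (Suc u * n) (rk n m c u)" using Suc by simp
  ultimately show ?case
    using slow_rk_step[OF n_pos] p_cands_nonempty[OF Suc.prems]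
    unfolding p_cands_Suc by (simp del: mult_Suc)
qed

lemma rk_origin: "u < d \<Longrightarrow> rk n m c u 0 = rk n m c 0 0"
proof (induction u)
  case (Suc u)
  then show ?case
    using ptilde_bounds(1)[OF Suc.prems] by (simp add: rk_step_def ptilde_Suc Let_def)
qed simp

lemma rk_final_sprod:
  assumes "j < n"
  shows "rk n m c (d - 1) (i * n + j) = rk n m c 0 (inv (stilde d n m c j) i * n + j)"
proof -
  have p: "ptilde n m c (Suc v) \<le> Suc v * n" if "v < d - 1" for v
    using ptilde_bounds(2) that by simp
  have "stilde d n m c j (inv (stilde d n m c j) i) = i"
    unfolding stilde_def using bij_sprod[OF p] by (simp add: bij_is_surj surj_f_inv_f)
  then show ?thesis
    using rk_sprod[where u = "d - 1" and i = "inv (stilde d n m c j) i", OF n_pos assms p]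
    by (simp add: stilde_def)
qed

lemma Phi_rk:
  assumes "x < d * n"
  shows "int n * Phi d n m c x = int m * int x - rk n m c (d - 1) x"
proof -
  define i j k where "i = x div n" and "j = x mod n" and "k = inv (stilde d n m c j) i"
  have x: "x = i * n + j" by (simp add: i_def j_def)
  have "j < n" using n_pos by (simp add: j_def)
  have Phi: "Phi d n m c x = c (k * n + j) - (int k - int i) * int m"
    using assms by (simp add: Phi_def i_def j_def k_def Let_def)
  have rk: "rk n m c (d - 1) x = int m * int (k * n + j) - int n * c (k * n + j)"
    using rk_final_sprod[OF \<open>j < n\<close>, of i] x by (simp add: k_def)
  have "int x = int i * int n + int j" using x by simp
  then show ?thesis unfolding Phi rk by (simp add: algebra_simps)
qed

lemma rk_nonneg:
  assumes "\<And>x. x < d * n \<Longrightarrow> 0 \<le> rk n m c 0 x"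
  shows "u < d \<Longrightarrow> x < d * n \<Longrightarrow> 0 \<le> rk n m c u x"
proof (induction u arbitrary: x)
  case 0
  then show ?case using assms by blast
next
  case (Suc u)
  have "Suc u * n + x mod n < Suc (Suc u) * n" using n_pos by simp
  also have "\<dots> \<le> d * n" using Suc.prems(1) by (intro mult_le_mono1) simp
  finally have "Suc u * n + x mod n < d * n" .
  moreover have "x - n < d * n" using Suc.prems(2) by simp
  ultimately show ?case
    using Suc by (simp add: rk_step_def Let_def)
qed

lemma Phi_in_Yfam:
  assumes origin: "c 0 = 0" and nonneg: "\<And>x. x < d * n \<Longrightarrow> 0 \<le> rk n m c 0 x"
  shows "Phi d n m c \<in> Yfam d n m"
proof -
  let ?y = "Phi d n m c"
  have mono: "?y x \<le> ?y (Suc x)" if "Suc x < d * n" for x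
  proof -
    have "slow m (d * n) (rk n m c (d - 1))" using slow_rk[of "d - 1"] d_pos by simp
    then have "rk n m c (d - 1) (Suc x) \<le> rk n m c (d - 1) x + int m"
      using that by (simp add: slow_def)
    moreover have "int m * int (Suc x) = int m * int x + int m" by (simp add: algebra_simps)
    ultimately have "int n * ?y x \<le> int n * ?y (Suc x)"
      using Phi_rk[of x] Phi_rk[OF that] that by simp
    then show ?thesis using n_pos by simp
  qed
  have lower: "0 \<le> ?y x" if "x < d * n" for x
    using that
  proof (induction x)
    case 0
    have "int n * ?y 0 = 0" using Phi_rk[OF 0] rk_origin[of "d - 1"] d_pos origin by simp
    then show ?case using n_pos by simp
  next
    case (Suc x)
    then show ?case using mono[OF Suc.prems] by simp
  qed
  have upper: "?y x \<le> int (abound n m x)" if "x < d * n" for x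
  proof (rule le_abound[OF n_pos])
    have "0 \<le> rk n m c (d - 1) x"
      by (rule rk_nonneg[OF nonneg _ that]) (use d_pos in simp_all)
    then show "0 \<le> int m * int x - int n * ?y x" using Phi_rk[OF that] by simp
  qed
  show ?thesis
    using mono lower upper by (auto simp: Yfam_def Phi_def)
qed

end

section \<open>The ranks of an admissible set\<close>

lemma generator_eq_rank:
  "int (ahat d n m x) - int (d * n) * c x = int d * rk n m c 0 x + int (x div n)"
proof -
  have "int x = int n * int (x div n) + int (x mod n)"
    by (metis mult_div_mod_eq of_nat_add of_nat_mult)
  then have "int m * int x = int m * (int n * int (x div n) + int (x mod n))" by simp
  then show ?thesis by (simp add: ahat_def algebra_simps)
qed

lemma generator_cong_ahat:
  assumes "int a = int d * rk n m c 0 x + int (x div n)"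
  shows "[a = ahat d n m x] (mod d * n)"
proof -
  have "int (ahat d n m x) = int a + int (d * n) * c x"
    using generator_eq_rank[of d n m x c] assms by simp
  then have "[int a = int (ahat d n m x)] (mod int (d * n))"
    by (simp add: cong_def del: of_nat_mult)
  then show ?thesis by (simp only: cong_int_iff)
qed

lemma Suc_mod_eq_mult:
  obtains q where "Suc (x mod n) = Suc x mod n + n * q"
proof
  show "Suc (x mod n) = Suc x mod n + n * (Suc (x mod n) div n)"
    using mod_mult_div_eq[of "Suc (x mod n)" n] by (simp add: mod_Suc_eq)
qed

text \<open>
  Wrapping around from the last column to the first one costs \<open>n * d * m\<close>, which vanishes modulo
  \<open>d * n\<close>; so \<open>d * m\<close> leads from each residue class to the next one of its row, read cyclically, and
  \<open>d * m + 1\<close> to the next column one row below.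
\<close>

lemma ahat_next_in_row:
  assumes n: "0 < n"
  shows "[ahat d n m (u * n + x mod n) + d * m = ahat d n m (u * n + Suc x mod n)] (mod d * n)"
proof -
  obtain q where q: "Suc (x mod n) = Suc x mod n + n * q" by (rule Suc_mod_eq_mult)
  have "ahat d n m (u * n + x mod n) + d * m = Suc (x mod n) * d * m + (d * m * n + 1) * u"
    using n by (simp add: ahat_def algebra_simps)
  also have "\<dots> = ahat d n m (u * n + Suc x mod n) + q * m * (d * n)"
    unfolding q using n by (simp add: ahat_def algebra_simps)
  finally show ?thesis by (simp add: cong_def)
qed

lemma ahat_next_row:
  assumes n: "0 < n"
  shows "[ahat d n m (u * n + x mod n) + d * m + 1 = ahat d n m (Suc u * n + Suc x mod n)]
    (mod d * n)"
proof -
  have "[ahat d n m (u * n + x mod n) + d * m + 1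
      = ahat d n m (u * n + x mod n) + d * m + (m * (d * n) + 1)] (mod d * n)"
    by (rule cong_add[OF cong_refl]) (simp only: cong_def mod_mult_self3)
  also have "[ahat d n m (u * n + x mod n) + d * m + (m * (d * n) + 1)
      = ahat d n m (u * n + Suc x mod n) + (m * (d * n) + 1)] (mod d * n)"
    using ahat_next_in_row[OF n] by (rule cong_add) simp
  also have "ahat d n m (u * n + Suc x mod n) + (m * (d * n) + 1)
      = ahat d n m (Suc u * n + Suc x mod n)"
    using n by (simp add: ahat_def algebra_simps)
  finally show ?thesis .
qed

text \<open>
  Both kinds of rank inequality in \<open>admissible_ranks\<close> are instances of the minimality of a generator
  in its residue class: exhibiting an element of \<open>\<Delta>\<close> in that class bounds the rank from above.
\<close>

lemma generator_least:
  assumes dn: "0 < d * n" and cl: "\<And>a. a \<in> \<Delta> \<Longrightarrow> a + d * n \<in> \<Delta>"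
    and c: "is_coords d n m \<Delta> c" and x: "x < d * n"
    and t: "t \<in> \<Delta>" "[t = ahat d n m x] (mod d * n)"
  shows "int d * rk n m c 0 x + int (x div n) \<le> int t"
proof -
  have "int d * rk n m c 0 x + int (x div n) \<in> int ` gens d n \<Delta>"
    using c x unfolding is_coords_def generator_eq_rank by blast
  then obtain a where a: "a \<in> gens d n \<Delta>" "int d * rk n m c 0 x + int (x div n) = int a"
    by auto
  have "t mod (d * n) = a mod (d * n)"
    using t(2) generator_cong_ahat[OF a(2)[symmetric]] by (simp add: cong_def)
  moreover have "\<forall>b\<in>\<Delta>. b < a \<longrightarrow> b mod (d * n) \<noteq> a mod (d * n)"
    using a(1) gens_eq[OF dn cl] by simp
  ultimately have "\<not> t < a" using t(1) by blast
  then show ?thesis using a(2) by simp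
qed

lemma coords_ranks:
  assumes d: "1 \<le> d" and n: "1 \<le> n" and cop: "coprime m n" and D: "\<Delta> \<in> Adm d n m"
  shows "admissible_ranks d n m (coords d n m \<Delta>)"
    and "coords d n m \<Delta> 0 = 0"
    and "x < d * n \<Longrightarrow> 0 \<le> rk n m (coords d n m \<Delta>) 0 x"
proof -
  define c where "c = coords d n m \<Delta>"
  let ?r = "rk n m c 0"
  have dn: "0 < d * n" using d n by simp
  have c: "is_coords d n m \<Delta> c"
    unfolding c_def coords_def using is_coords_ex1[OF d n cop D] by (rule theI')
  have add_Gam: "g + a \<in> \<Delta>" if "g \<in> Gam d n m" "a \<in> \<Delta>" for g a
    using D that by (auto simp: Adm_def)
  have "d * n \<in> Gam d n m"
    unfolding Gam_def by (intro CollectI exI[of _ 1] exI[of _ 0] conjI) auto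
  then have cl: "a + d * n \<in> \<Delta>" if "a \<in> \<Delta>" for a
    using add_Gam that by (metis add.commute)
  have "d * m \<in> Gam d n m"
    unfolding Gam_def by (intro CollectI exI[of _ 0] exI[of _ 1] conjI) auto
  then have dm: "a + d * m \<in> \<Delta>" if "a \<in> \<Delta>" for a
    using add_Gam that by (metis add.commute)
  have gens: "int ` gens d n \<Delta> = (\<lambda>x. int d * ?r x + int (x div n)) ` {..<d * n}"
    using c unfolding is_coords_def generator_eq_rank by blast
  have gens_sub: "a \<in> \<Delta>" if "a \<in> gens d n \<Delta>" for a
    using that gens_eq[OF dn cl] by simp
  have gen: "\<exists>a\<in>gens d n \<Delta>. int a = int d * ?r x + int (x div n) \<and> [a = ahat d n m x] (mod d * n)"
    if "x < d * n" for x
  proof -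
    have "int d * ?r x + int (x div n) \<in> int ` gens d n \<Delta>" using gens that by blast
    then obtain a where a: "a \<in> gens d n \<Delta>" "int a = int d * ?r x + int (x div n)" by auto
    then show ?thesis using generator_cong_ahat[OF a(2)] by auto
  qed
  have idx: "u * n + k mod n < d * n" if "u < d" for u k
  proof -
    have "u * n + k mod n < Suc u * n" using n by simp
    also have "\<dots> \<le> d * n" using that by (intro mult_le_mono1) simp
    finally show ?thesis .
  qed
  have dv: "(u * n + k mod n) div n = u" for u k using n by simp
  have least: "int d * ?r z + int (z div n) \<le> int t"
    if "z < d * n" "t \<in> \<Delta>" "[t = ahat d n m z] (mod d * n)" for z t
    using cl by (rule generator_least[OF dn _ c that])

  show "x < d * n \<Longrightarrow> 0 \<le> ?r x" for x
  proof -
    assume x: "x < d * n"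
    then obtain a where "int a = int d * ?r x + int (x div n)" using gen by blast
    then have "0 \<le> int d * ?r x + int (x div n)" by simp
    moreover have "int (x div n) < int d" using x by (simp add: less_mult_imp_div_less)
    (* x div n < d, so a rank of -1 or less would make the generator negative *)
    ultimately have "int d * (- 1) < int d * ?r x" by simp
    then have "- 1 < ?r x" using d by (simp only: mult_less_cancel_left_pos)
    then show "0 \<le> ?r x" by linarith
  qed

  show "c 0 = 0" using c dn by (force simp: is_coords_def abound_def)

  show "admissible_ranks d n m c"
  proof
    show "0 < d" "0 < n" using d n by simp_all
    show "cyclically_slow_row n m ?r u" if u: "u < d" for u
      unfolding cyclically_slow_row_def
    proof
      fix x
      let ?y = "u * n + x mod n" and ?z = "u * n + Suc x mod n"
      obtain a where a: "a \<in> gens d n \<Delta>" "int a = int d * ?r ?y + int u"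
        "[a = ahat d n m ?y] (mod d * n)"
        using gen[OF idx[OF u, of x]] unfolding dv by blast
      have "[a + d * m = ahat d n m ?y + d * m] (mod d * n)"
        using a(3) by (rule cong_add) simp
      also have "[ahat d n m ?y + d * m = ahat d n m ?z] (mod d * n)"
        using n by (intro ahat_next_in_row) simp
      finally have "int d * ?r ?z + int u \<le> int (a + d * m)"
        using least[OF idx[OF u, of "Suc x"] dm[OF gens_sub[OF a(1)]]] unfolding dv by simp
      then have "int d * ?r ?z \<le> int d * (?r ?y + int m)" using a(2) by (simp add: algebra_simps)
      then show "?r ?z \<le> ?r ?y + int m" using d by simp
    qed
    show "\<exists>j<n. ?r (Suc u * n + Suc j mod n) \<le> ?r (u * n + j) + int m" if u: "Suc u < d" for u
    proof -
      have "u < d" using u by simp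
      then have "\<exists>a\<in>gens d n \<Delta>. a mod d = u mod d \<and> a + d * m + 1 \<in> \<Delta>"
        using D unfolding Adm_def by blast
      then obtain a where a: "a \<in> gens d n \<Delta>" "a mod d = u" "a + d * m + 1 \<in> \<Delta>"
        using \<open>u < d\<close> by auto
      have "int a \<in> int ` gens d n \<Delta>" using a(1) by blast
      then obtain y where y: "y < d * n" "int a = int d * ?r y + int (y div n)"
        unfolding gens by auto
      have "int (a mod d) = int (y div n)"
        using y by (simp add: zmod_int less_mult_imp_div_less)
      then have "y div n = u" using a(2) by simp
      then have y': "y = u * n + y mod n" by (metis div_mult_mod_eq)
      let ?z = "Suc u * n + Suc y mod n"
      have "[a = ahat d n m y] (mod d * n)" using y(2) by (rule generator_cong_ahat)
      then have "[a + (d * m + 1) = ahat d n m y + (d * m + 1)] (mod d * n)"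
        by (rule cong_add) simp
      also have "[ahat d n m y + (d * m + 1) = ahat d n m ?z] (mod d * n)"
        using ahat_next_row[of n d m u y] n unfolding y'[symmetric] by (simp add: add.assoc)
      finally have "int d * ?r ?z + int (Suc u) \<le> int (a + d * m + 1)"
        using least[OF idx[OF u, of "Suc y"] a(3)] unfolding dv by (simp add: add.assoc)
      then have "int d * ?r ?z \<le> int d * (?r y + int m)"
        using y(2) \<open>y div n = u\<close> by (simp add: algebra_simps)
      then have "?r ?z \<le> ?r y + int m" using d by simp
      then show ?thesis
        using n y' mod_Suc_eq[of y n] by (intro exI[of _ "y mod n"]) simp
    qed
  qed
qed

theorem proposition4p3:
  fixes d n m :: nat
  assumes "1 \<le> d" and "1 \<le> n" and "n < m" and "coprime m n"
  shows "(\<forall>\<Delta>\<in>Adm d n m.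
            (\<forall>u\<in>{1..d - 1}. p_cands n m (coords d n m \<Delta>) u \<noteq> {}) \<and>
            (\<forall>u\<in>{1..d - 1}. 0 < ptilde n m (coords d n m \<Delta>) u) \<and>
            strict_mono_on {1..d - 1} (ptilde n m (coords d n m \<Delta>)) \<and>
            (\<forall>u\<in>{1..d - 1}. ptilde n m (coords d n m \<Delta>) u \<le> (d - 1) * n)) \<and>
         (\<lambda>\<Delta>. Phi d n m (coords d n m \<Delta>)) \<in> Adm d n m \<rightarrow> Yfam d n m"
proof (intro conjI ballI funcsetI)
  fix \<Delta> assume D: "\<Delta> \<in> Adm d n m"
  note ranks = coords_ranks[OF assms(1,2,4) D]
  interpret admissible_ranks d n m "coords d n m \<Delta>" by (rule ranks(1))
  show "strict_mono_on {1..d - 1} (ptilde n m (coords d n m \<Delta>))" by (rule strict_mono_ptilde)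
  show "Phi d n m (coords d n m \<Delta>) \<in> Yfam d n m" using ranks(2,3) by (rule Phi_in_Yfam)
  fix u assume "u \<in> {1..d - 1}"
  then obtain v where v: "u = Suc v" "Suc v < d" by (cases u) auto
  show "p_cands n m (coords d n m \<Delta>) u \<noteq> {}" using p_cands_nonempty v by simp
  show "0 < ptilde n m (coords d n m \<Delta>) u" using ptilde_bounds(1) v by simp
  have "ptilde n m (coords d n m \<Delta>) u \<le> Suc v * n" using ptilde_bounds(2) v by simp
  also have "\<dots> \<le> (d - 1) * n" using v by (intro mult_le_mono1) simp
  finally show "ptilde n m (coords d n m \<Delta>) u \<le> (d - 1) * n" .
qed

end
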